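(* For any (possibly adaptive, possibly randomized) ranking algorithm $A$ that uses comparisons of set size at most $l$, even if $A$ is given the values $\{\theta_1,\dots,\theta_n\}$ (but not which item has which value), if $A$ identifies the top-$k$ items with probability at least $7/8$ then $A$ uses \[ \Omega\Biggl( \frac{n}{l} + k + \frac{\sum_{i \geq k+1} \theta_{i}}{\theta_k} + \sum_{i \geq k+1,\ \theta_i \geq \frac{\theta_k}{2}} \frac{\theta_{k}^2}{(\theta_k - \theta_i)^2} + \sum_{i:\, i\leq k,\ \theta_i \leq 2\theta_{k+1}} \frac{\theta_{k+1}^2}{(\theta_{k+1} - \theta_i)^2} \Biggr) \] comparisons.
   Context: Top-$k$ ranking under the multinomial logit (MNL) model. There are $n$ items with positive preference scores $\theta_1 \geq \theta_2 \geq \cdots \geq \theta_k > \theta_{k+1} \geq \cdots \geq \theta_n$; the true top-$k$ items are those with scores $\theta_1,\dots,\theta_k$. The algorithm initially sees the items only through labels assigned by a uniformly random permutation $\pi$ of $\{1,\dots,n\}$ (the item with score $\theta_i$ gets label $\pi_i$). At each round $t$ the algorithm chooses (possibly adaptively, based on previous outcomes) a set $S_t$ of items with $2 \leq |S_t| \leq l$ and observes a single item $a\in S_t$, drawn independently of the past given $S_t$ with $\Pr[a \mid S_t] = \theta_a / \sum_{j\in S_t}\theta_j$. Each round counts as one comparison. The algorithm succeeds if it outputs $\{\pi_1,\dots,\pi_k\}$; probabilities are over $\pi$, the comparison outcomes and the algorithm's randomness. *)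

theory Defs
  imports "HOL-Probability.Probability" "HOL-Combinatorics.Permutations"
begin

text \<open>Item \<open>i \<in> {1..n}\<close> has score \<open>\<theta> i\<close>; items are numbered by non-increasing score.\<close>

definition topk_instance :: "nat \<Rightarrow> nat \<Rightarrow> (nat \<Rightarrow> real) \<Rightarrow> bool" where
  "topk_instance n k \<theta> \<longleftrightarrow>
     1 \<le> k \<and> k < n \<and>
     (\<forall>i\<in>{1..n}. \<theta> i > 0) \<and>
     (\<forall>i\<in>{1..n}. \<forall>j\<in>{1..n}. i \<le> j \<longrightarrow> \<theta> j \<le> \<theta> i) \<and>
     \<theta> k > \<theta> (k + 1)"

text \<open>The multinomial logit choice from \<open>S\<close>. It is meaningful only for finite non-empty \<open>S\<close>
  and scores \<open>w\<close> that are positive on \<open>S\<close>, see \<open>pmf_mnl_choice\<close> below.\<close>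

definition mnl_choice :: "(nat \<Rightarrow> real) \<Rightarrow> nat set \<Rightarrow> nat pmf" where
  "mnl_choice w S = embed_pmf (\<lambda>a. if a \<in> S then w a / (\<Sum>j\<in>S. w j) else 0)"

lemma pmf_mnl_choice:
  assumes "finite S" "S \<noteq> {}" "\<And>a. a \<in> S \<Longrightarrow> w a > 0"
  shows "pmf (mnl_choice w S) a = (if a \<in> S then w a / (\<Sum>j\<in>S. w j) else 0)"
proof -
  let ?f = "\<lambda>a. if a \<in> S then w a / (\<Sum>j\<in>S. w j) else 0"
  have pos: "(\<Sum>j\<in>S. w j) > 0"
    using assms by (intro sum_pos) auto
  have nonneg: "?f x \<ge> 0" for x
    using pos assms(3)[of x] by (simp add: less_imp_le)
  have "(\<integral>\<^sup>+x. ennreal (?f x) \<partial>count_space UNIV) = (\<Sum>x\<in>S. ennreal (?f x))"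
    using assms(1) by (intro nn_integral_count_space'[of S]) auto
  also have "\<dots> = ennreal (\<Sum>x\<in>S. ?f x)"
    using nonneg by (intro sum_ennreal) blast
  also have "(\<Sum>x\<in>S. ?f x) = 1"
    using pos by (simp flip: sum_divide_distrib)
  finally have "(\<integral>\<^sup>+x. ennreal (?f x) \<partial>count_space UNIV) = 1"
    by simp
  with nonneg show ?thesis
    unfolding mnl_choice_def by (subst pmf_embed_pmf) auto
qed

text \<open>An algorithm maps the history (the sets compared so far, each with its winner, in
  chronological order) to a random decision: compare another set of labels, or stop and output
  a set of labels. Its internal randomness is the law of the next decision given the history;
  as there are only finitely many sets of labels, this includes algorithms that draw all their
  random bits in advance.\<close>

datatype decision = Compare "nat set" | Output "nat set"

type_synonym history = "(nat set \<times> nat) list"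
type_synonym algorithm = "history \<Rightarrow> decision pmf"

definition valid_algorithm :: "nat \<Rightarrow> nat \<Rightarrow> algorithm \<Rightarrow> bool" where
  "valid_algorithm n l A \<longleftrightarrow>
     (\<forall>h S. Compare S \<in> set_pmf (A h) \<longrightarrow> S \<subseteq> {1..n} \<and> 2 \<le> card S \<and> card S \<le> l)"

text \<open>\<open>run w A T h\<close> continues \<open>A\<close> from history \<open>h\<close>, label \<open>a\<close> having score \<open>w a\<close>. The result is
  \<open>Some X\<close> if \<open>A\<close> outputs \<open>X\<close> after at most \<open>T\<close> further comparisons, and \<open>None\<close> if it asks
  for more than \<open>T\<close>.\<close>

primrec run :: "(nat \<Rightarrow> real) \<Rightarrow> algorithm \<Rightarrow> nat \<Rightarrow> history \<Rightarrow> nat set option pmf" where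
  "run w A 0 h = do {
     d \<leftarrow> A h;
     case d of
       Output X \<Rightarrow> return_pmf (Some X)
     | Compare S \<Rightarrow> return_pmf None }"
| "run w A (Suc T) h = do {
     d \<leftarrow> A h;
     case d of
       Output X \<Rightarrow> return_pmf (Some X)
     | Compare S \<Rightarrow> do {
         a \<leftarrow> mnl_choice w S;
         run w A T (h @ [(S, a)]) } }"

text \<open>Item \<open>i\<close> carries the label \<open>\<pi> i\<close>, so label \<open>a\<close> has score \<open>\<theta> (inv \<pi> a)\<close>.\<close>

definition topk_experiment ::
    "nat \<Rightarrow> (nat \<Rightarrow> real) \<Rightarrow> algorithm \<Rightarrow> nat \<Rightarrow> ((nat \<Rightarrow> nat) \<times> nat set option) pmf" where
  "topk_experiment n \<theta> A T = do {
     \<pi> \<leftarrow> pmf_of_set {\<pi>. \<pi> permutes {1..n}};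
     r \<leftarrow> run (\<lambda>a. \<theta> (inv \<pi> a)) A T [];
     return_pmf (\<pi>, r) }"

text \<open>The probability that \<open>A\<close> outputs the labels of the top \<open>k\<close> items after at most \<open>T\<close>
  comparisons. If \<open>A\<close> never makes more than \<open>T\<close> comparisons, this is its probability of
  success.\<close>

definition success_prob :: "nat \<Rightarrow> nat \<Rightarrow> (nat \<Rightarrow> real) \<Rightarrow> algorithm \<Rightarrow> nat \<Rightarrow> real" where
  "success_prob n k \<theta> A T =
     measure_pmf.prob (topk_experiment n \<theta> A T) {(\<pi>, r). r = Some (\<pi> ` {1..k})}"

end

theory Submission
  imports Defs
begin

text \<open>Pair every item \<open>i\<close> with the item \<open>j\<close> across the boundary (\<open>j = k + 1\<close> if \<open>i \<le> k\<close>, otherwise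
  \<open>j = k\<close>) and let the label of \<open>i\<close> have the score of \<open>j\<close>. The perturbed scores do not change if
  the labels of \<open>i\<close> and \<open>j\<close> are swapped, so averaged over \<open>\<pi>\<close> the algorithm then puts both of them
  on their correct sides with probability at most 1/2, whereas under the true scores it does so with
  probability at least 7/8. Hence the two laws of the output differ by a constant, and by the
  Donsker-Varadhan inequality this difference is paid for round by round. A round with set \<open>S\<close> costs
  at most a constant if the label of \<open>i\<close> is in \<open>S\<close> (this gives \<open>n / l\<close>), a constant times its winning
  probability if its score was lowered (this gives \<open>k\<close>), and always at most
  \<open>(\<theta> j - \<theta> i)\<^sup>2 / (\<theta> j * \<theta> i)\<close> times its winning probability (this gives the three sums). Changing one
  score instead of swapping two is essential: the costs of different items then add up to at most
  the number of rounds, as each round has only one winner.\<close>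

section \<open>Expectations of bounded functions under a pmf\<close>

lemma integrable_pmf_bounded:
  fixes f :: "'a \<Rightarrow> real"
  assumes "\<And>x. lo \<le> f x" "\<And>x. f x \<le> hi"
  shows "integrable (measure_pmf p) f"
proof (rule measure_pmf.integrable_const_bound[where B = "max \<bar>lo\<bar> \<bar>hi\<bar>"])
  show "AE x in measure_pmf p. norm (f x) \<le> max \<bar>lo\<bar> \<bar>hi\<bar>"
    using assms by (intro AE_I2) (smt (verit) real_norm_def)
qed simp

lemma expectation_pmf_bounds:
  fixes f :: "'a \<Rightarrow> real"
  assumes "\<And>x. lo \<le> f x" "\<And>x. f x \<le> hi"
  shows "lo \<le> measure_pmf.expectation p f" "measure_pmf.expectation p f \<le> hi"
  using integrable_pmf_bounded[OF assms, of p] assms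
  by (auto intro!: measure_pmf.integral_ge_const measure_pmf.integral_le_const)

lemma expectation_bind_pmf:
  fixes f :: "'b \<Rightarrow> real"
  assumes "\<And>x. lo \<le> f x" "\<And>x. f x \<le> hi"
  shows "measure_pmf.expectation (bind_pmf p q) f =
    measure_pmf.expectation p (\<lambda>x. measure_pmf.expectation (q x) f)"
  unfolding measure_pmf_bind
proof (rule integral_bind[where K = "count_space UNIV" and B' = 1 and B = "max \<bar>lo\<bar> \<bar>hi\<bar>"])
  show "\<bar>f x\<bar> \<le> max \<bar>lo\<bar> \<bar>hi\<bar>" for x
    using assms[of x] by linarith
  show "AE x in measure_pmf p. emeasure (measure_pmf (q x)) (space (measure_pmf (q x))) \<le> ennreal 1"
    by (simp add: measure_pmf.emeasure_space_1)
  show "(\<lambda>x. measure_pmf (q x)) \<in> measurable (measure_pmf p) (subprob_algebra (count_space UNIV))"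
    by (simp add: measurable_def space_subprob_algebra subprob_space_measure_pmf)
qed (simp_all add: measure_pmf.finite_measure_axioms)

text \<open>Jensen's inequality for the concave \<open>ln\<close>, by integrating its tangent at the
  mean. The bounds on \<open>f\<close> keep both \<open>f\<close> and \<open>ln (f x)\<close>
  bounded, hence integrable.\<close>

lemma expectation_ln_le:
  fixes f :: "'a \<Rightarrow> real"
  assumes "\<And>x. 1 \<le> f x" "\<And>x. f x \<le> hi"
  shows "measure_pmf.expectation p (\<lambda>x. ln (f x)) \<le> ln (measure_pmf.expectation p f)"
proof -
  let ?m = "measure_pmf.expectation p f"
  have m: "1 \<le> ?m"
    using assms by (rule expectation_pmf_bounds(1))
  have int: "integrable (measure_pmf p) f"
    using assms by (rule integrable_pmf_bounded)
  have int': "integrable (measure_pmf p) (\<lambda>x. ln (f x))"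
  proof (rule integrable_pmf_bounded)
    show "0 \<le> ln (f x)" "ln (f x) \<le> ln hi" for x
      using assms[of x] by auto
  qed
  have "measure_pmf.expectation p (\<lambda>x. ln (f x))
      \<le> measure_pmf.expectation p (\<lambda>x. ln ?m + (f x / ?m - 1))"
  proof (intro integral_mono)
    fix x
    have "ln (f x / ?m) \<le> f x / ?m - 1"
      using m assms(1)[of x] by (intro ln_le_minus_one divide_pos_pos) auto
    then show "ln (f x) \<le> ln ?m + (f x / ?m - 1)"
      using m assms(1)[of x] by (simp add: ln_div)
  qed (use int int' in auto)
  also have "\<dots> = ln ?m"
    using m int by simp
  finally show ?thesis .
qed

section \<open>One multinomial logit choice under a single changed score\<close>

lemma expectation_mnl_choice:
  assumes "finite S" "S \<noteq> {}" "\<And>a. a \<in> S \<Longrightarrow> w a > 0"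
  shows "measure_pmf.expectation (mnl_choice w S) f = (\<Sum>a\<in>S. f a * (w a / sum w S))"
proof -
  have "measure_pmf.expectation (mnl_choice w S) f = (\<Sum>a\<in>S. f a * pmf (mnl_choice w S) a)"
    by (rule integral_measure_pmf_real) 
      (use assms in \<open>auto simp: set_pmf_eq pmf_mnl_choice split: if_splits\<close>)
  then show ?thesis
    by (simp add: pmf_mnl_choice assms)
qed

text \<open>In the following one-step bounds, \<open>F\<close> stands for the exponential of a test function: each bound
  has the form of the Donsker-Varadhan inequality, with the relative entropy of the two choices
  replaced by an upper bound.\<close>

lemma mnl_choice_step_kl:
  fixes w F :: "nat \<Rightarrow> real"
  assumes S: "finite S" "S \<noteq> {}" and w: "\<And>x. x \<in> S \<Longrightarrow> w x > 0"
    and wb: "w b > 0" and v: "v > 0"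
    and F: "\<And>x. 1 \<le> F x" 
  shows "measure_pmf.expectation (mnl_choice w S) (\<lambda>x. ln (F x))
    \<le> ln (measure_pmf.expectation (mnl_choice (w(b := v)) S) F)
      + (v - w b)\<^sup>2 / (v * w b) * measure_pmf.expectation (mnl_choice w S) (\<lambda>x. of_bool (x = b))"
proof -
  define w' where "w' = w(b := v)"
  have w': "w' x > 0" if "x \<in> S" for x
    using w[OF that] v by (auto simp: w'_def)
  define p where "p x = w x / sum w S" for x
  define p' where "p' x = w' x / sum w' S" for x
  have Z: "sum w S > 0" and Z': "sum w' S > 0"
    using S w w' by (auto intro!: sum_pos)
  have p: "p x > 0" and p': "p' x > 0" if "x \<in> S" for x
    using w w' Z Z' that by (auto simp: p_def p'_def)
  have sp: "sum p S = 1" and sp': "sum p' S = 1"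
    using Z Z' by (auto simp: p_def p'_def simp flip: sum_divide_distrib)
  define m where "m = (\<Sum>x\<in>S. F x * p' x)"
  have "(\<Sum>x\<in>S. 1 * p' x) \<le> m"
    unfolding m_def by (intro sum_mono mult_right_mono) (use F p' in \<open>auto intro: less_imp_le\<close>)
  then have m: "1 \<le> m"
    by (simp add: sp')
  \<comment> \<open>The pointwise form of the Donsker-Varadhan inequality:
    \<open>ln y \<le> y - 1\<close> at \<open>y = F x * p' x / (p x * m)\<close>, weighted by
    \<open>p x\<close>. In the sum over \<open>S\<close> the middle bracket vanishes, since
    \<open>F x * p' x / m\<close> and \<open>p x\<close> both sum to 1.\<close>
  have "ln (F x) * p x \<le> p x * ln m + (F x * p' x / m - p x) + p x * ln (p x / p' x)"
    if x: "x \<in> S" for x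
  proof -
    have "ln (F x * p' x / (p x * m)) \<le> F x * p' x / (p x * m) - 1"
      using F[of x] p[OF x] p'[OF x] m by (intro ln_le_minus_one divide_pos_pos mult_pos_pos) auto
    moreover have "ln (F x * p' x / (p x * m)) = ln (F x) - ln m - ln (p x / p' x)"
      using F[of x] p[OF x] p'[OF x] m by (simp add: ln_div ln_mult)
    ultimately have "p x * (ln (F x) - ln m - ln (p x / p' x)) \<le> p x * (F x * p' x / (p x * m) - 1)"
      using p[OF x] by (intro mult_left_mono) auto
    also have "\<dots> = F x * p' x / m - p x"
      using p[OF x] m by (simp add: field_simps)
    finally show ?thesis
      by (simp add: algebra_simps)
  qed
  then have "(\<Sum>x\<in>S. ln (F x) * p x)
      \<le> (\<Sum>x\<in>S. p x * ln m + (F x * p' x / m - p x) + p x * ln (p x / p' x))"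
    by (rule sum_mono)
  also have "\<dots> = ln m + (\<Sum>x\<in>S. p x * ln (p x / p' x))"
    using m by (simp add: sum.distrib sum_subtractf sp flip: sum_distrib_right sum_divide_distrib m_def)
  also have "(\<Sum>x\<in>S. p x * ln (p x / p' x))
      \<le> (v - w b)\<^sup>2 / (v * w b) * (\<Sum>x\<in>S. of_bool (x = b) * p x)"
  proof (cases "b \<in> S")
    case False
    then have "w' x = w x" if "x \<in> S" for x
      using that by (auto simp: w'_def)
    then have "p' x = p x" if "x \<in> S" for x
      using that by (simp add: p_def p'_def cong: sum.cong)
    then have "(\<Sum>x\<in>S. p x * ln (p x / p' x)) = 0"
      using p by (intro sum.neutral) (auto simp: less_imp_neq[symmetric])
    moreover have "(\<Sum>x\<in>S. of_bool (x = b) * p x) = 0"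
      using False by (intro sum.neutral) (auto simp: of_bool_def)
    ultimately show ?thesis by simp
  next
    case True
    have ZZ: "sum w' S = sum w S + (v - w b)"
      unfolding w'_def using sum.remove[OF S(1) True, of w] sum.remove[OF S(1) True, of "w(b := v)"]
      by (simp cong: sum.cong_simp)
    \<comment> \<open>The likelihood ratio splits into the ratio of the normalising sums, common to
      all \<open>x\<close>, and the ratio of the scores, which differs from 1 at most at
      \<open>b\<close>.\<close>
    have "p x * ln (p x / p' x) = p x * ln (sum w' S / sum w S) + of_bool (x = b) * p x * ln (w b / v)"
      if x: "x \<in> S" for x
    proof -
      have "ln (p x / p' x) = ln (sum w' S / sum w S) + ln (w x / w' x)"
        using w[OF x] w'[OF x] Z Z' by (simp add: p_def p'_def ln_div ln_mult)
      then show ?thesis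
        using w[OF x] by (simp add: w'_def indicator_def algebra_simps)
    qed
    then have "(\<Sum>x\<in>S. p x * ln (p x / p' x))
        = ln (sum w' S / sum w S) + (\<Sum>x\<in>S. of_bool (x = b) * p x) * ln (w b / v)"
      by (simp add: sum.distrib sp flip: sum_distrib_right)
    also have pb: "(\<Sum>x\<in>S. of_bool (x = b) * p x) = p b"
      using S True by (simp add: of_bool_def if_distrib[of "\<lambda>y. y * _"] cong: if_cong)
    \<comment> \<open>Both logarithms are bounded by \<open>y - 1\<close>. Their first-order terms
      in \<open>v - w b\<close> cancel in the sum, which leaves a cost quadratic in the change of
      the score.\<close>
    also have "ln (sum w' S / sum w S) \<le> sum w' S / sum w S - 1"
      using Z Z' by (intro ln_le_minus_one divide_pos_pos) auto
    also have "\<dots> = p b * (v / w b - 1)"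
      using Z wb by (simp add: ZZ p_def field_simps)
    also have "ln (w b / v) \<le> w b / v - 1"
      using wb v by (intro ln_le_minus_one divide_pos_pos) auto
    also have "p b * (v / w b - 1) + p b * (w b / v - 1) = (v - w b)\<^sup>2 / (v * w b) * p b"
      using wb v by (simp add: field_simps power2_eq_square)
    finally show ?thesis
      using p[OF True] by (simp add: pb)
  qed
  finally show ?thesis
    using S w w' by (simp add: expectation_mnl_choice m_def p_def p'_def flip: w'_def)
qed

text \<open>Lowering the score of \<open>b\<close> cannot decrease the winning probability of any
  other label in \<open>S\<close>. So passing to the lowered score can reduce the expectation of
  \<open>F\<close> only through \<open>b\<close>, by at most 3 times the winning probability of
  \<open>b\<close>. This bound stays useful when the lowered score is a tiny fraction of the old
  one.\<close>

lemma mnl_choice_step_win: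
  fixes w F :: "nat \<Rightarrow> real"
  assumes S: "finite S" "S \<noteq> {}" and w: "\<And>x. x \<in> S \<Longrightarrow> w x > 0"
    and v: "v > 0" "v \<le> w b"
    and F: "\<And>x. 1 \<le> F x" "\<And>x. F x \<le> 3"
  shows "measure_pmf.expectation (mnl_choice w S) (\<lambda>x. ln (F x))
    \<le> ln (measure_pmf.expectation (mnl_choice (w(b := v)) S) F)
      + 3 * measure_pmf.expectation (mnl_choice w S) (\<lambda>x. of_bool (x = b))"
proof -
  define w' where "w' = w(b := v)"
  have w': "w' x > 0" "w' x \<le> w x" if "x \<in> S" for x
    using w[OF that] v by (auto simp: w'_def)
  have Z': "sum w' S > 0" "sum w' S \<le> sum w S"
    using S w' by (auto intro!: sum_pos sum_mono)
  let ?E = "measure_pmf.expectation (mnl_choice w S)"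
  let ?E' = "measure_pmf.expectation (mnl_choice w' S)"
  have E: "?E f = (\<Sum>a\<in>S. f a * (w a / sum w S))" for f
    using S w by (rule expectation_mnl_choice)
  have E': "?E' f = (\<Sum>a\<in>S. f a * (w' a / sum w' S))" for f
    using S w'(1) by (rule expectation_mnl_choice)
  have E1: "1 \<le> ?E F" and E'1: "1 \<le> ?E' F"
    using F by (auto intro!: expectation_pmf_bounds(1)[of 1 F 3])
  have i0: "0 \<le> ?E (\<lambda>x. of_bool (x = b) :: real)" 
    by (rule integral_nonneg_AE) simp
  have "?E F \<le> (\<Sum>x\<in>S. F x * (w' x / sum w' S) + 3 * (of_bool (x = b) * (w x / sum w S)))"
    unfolding E
  proof (rule sum_mono)
    fix x assume x: "x \<in> S"
    show "F x * (w x / sum w S) \<le> F x * (w' x / sum w' S) + 3 * (of_bool (x = b) * (w x / sum w S))"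
    proof (cases "x = b")
      case True
      have "F x * (w x / sum w S) \<le> 3 * (w x / sum w S)"
        using F(2)[of x] w[OF x] Z' by (intro mult_right_mono) auto
      moreover have "0 \<le> F x * (w' x / sum w' S)"
        using F(1)[of x] w'[OF x] Z' by simp
      ultimately show ?thesis 
        using True by simp
    next
      case False
      then have "w x / sum w S \<le> w' x / sum w' S"
        using w[OF x] Z' by (auto simp: w'_def intro!: divide_left_mono)
      then have "F x * (w x / sum w S) \<le> F x * (w' x / sum w' S)"
        using F(1)[of x] by (intro mult_left_mono) auto
      then show ?thesis
        using False by simp
    qed
  qed
  also have "\<dots> = ?E' F + 3 * ?E (\<lambda>x. of_bool (x = b))"
    unfolding E E' by (simp add: sum.distrib sum_distrib_left)
  finally have le: "?E F / ?E' F \<le> 1 + 3 * ?E (\<lambda>x. of_bool (x = b)) / ?E' F"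
    using E'1 by (simp add: field_simps)
  have "?E (\<lambda>x. ln (F x)) \<le> ln (?E F)"
    using F by (rule expectation_ln_le)
  also have "\<dots> = ln (?E' F) + ln (?E F / ?E' F)"
    using E1 E'1 by (simp add: ln_div)
  also have "ln (?E F / ?E' F) \<le> ?E F / ?E' F - 1"
    using E1 E'1 by (intro ln_le_minus_one divide_pos_pos) auto
  also have "\<dots> \<le> 3 * ?E (\<lambda>x. of_bool (x = b)) / ?E' F"
    using le by simp
  also have "\<dots> \<le> 3 * ?E (\<lambda>x. of_bool (x = b))"
    using divide_left_mono[OF E'1, of "3 * ?E (\<lambda>x. of_bool (x = b))"] E'1 i0 by simp
  finally show ?thesis
    unfolding w'_def by (simp del: fun_upd_apply)
qed

text \<open>If \<open>b\<close> is not in \<open>S\<close>, both choices have the same law and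
  Jensen's inequality suffices. Otherwise the constant 2 pays for the whole left side, as
  \<open>ln (F x) \<le> 2\<close> and the logarithm on the right is nonnegative.\<close>

lemma mnl_choice_step_member:
  fixes w F :: "nat \<Rightarrow> real"
  assumes F: "\<And>x. 1 \<le> F x" "\<And>x. F x \<le> 3"
  shows "measure_pmf.expectation (mnl_choice w S) (\<lambda>x. ln (F x))
    \<le> ln (measure_pmf.expectation (mnl_choice (w(b := v)) S) F)
      + 2 * measure_pmf.expectation (mnl_choice w S) (\<lambda>_. of_bool (b \<in> S))"
proof (cases "b \<in> S")
  case True
  have "ln (F x) \<le> 2" for x
    using F[of x] ln_le_minus_one[of "F x"] by simp
  then have "measure_pmf.expectation (mnl_choice w S) (\<lambda>x. ln (F x)) \<le> 2"
    using F by (intro expectation_pmf_bounds(2)[of 0]) auto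
  moreover have "1 \<le> measure_pmf.expectation (mnl_choice (w(b := v)) S) F"
    using F by (rule expectation_pmf_bounds(1))
  ultimately show ?thesis
    using True by (simp add: add_increasing)
next
  case False
  then have "mnl_choice (w(b := v)) S = mnl_choice w S"
    unfolding mnl_choice_def by (intro arg_cong[where f = embed_pmf] ext) (auto intro!: sum.cong)
  then show ?thesis
    using False expectation_ln_le[OF F, of "mnl_choice w S"] by simp
qed


section \<open>Accumulating the one-round costs along a run\<close>

text \<open>The recursion mirrors \<open>run\<close>, so that both can be handled in one induction.
  Nothing is charged at budget 0: a comparison requested there ends the run before a winner is
  drawn.\<close>

primrec expected_cost ::
    "(nat \<Rightarrow> real) \<Rightarrow> algorithm \<Rightarrow> (nat set \<Rightarrow> nat \<Rightarrow> real) \<Rightarrow> nat \<Rightarrow> history \<Rightarrow> real" where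
  "expected_cost w A c 0 h = 0"
| "expected_cost w A c (Suc T) h = measure_pmf.expectation (A h) (\<lambda>d. case d of
     Compare S \<Rightarrow> measure_pmf.expectation (mnl_choice w S)
       (\<lambda>a. c S a + expected_cost w A c T (h @ [(S, a)]))
   | Output X \<Rightarrow> 0)"

lemma expected_cost_bounds:
  assumes c: "\<And>S a. 0 \<le> c S a" "\<And>S a. c S a \<le> 1"
  shows "0 \<le> expected_cost w A c T h \<and> expected_cost w A c T h \<le> real T"
proof (induction T arbitrary: h)
  case (Suc T)
  have "0 \<le> c S a + expected_cost w A c T (h @ [(S, a)])"
    and "c S a + expected_cost w A c T (h @ [(S, a)]) \<le> real (Suc T)" for S a
    using c[of S a] Suc[of "h @ [(S, a)]"] by auto
  note inner = expectation_pmf_bounds[where lo = 0 and hi = "real (Suc T)", OF this]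
  show ?case
    unfolding expected_cost.simps
    by (intro conjI expectation_pmf_bounds[where lo = 0 and hi = "real (Suc T)"])
      (auto split: decision.split intro: inner simp del: of_nat_Suc)
qed simp

lemma expectation_run_Suc:
  fixes g :: "nat set option \<Rightarrow> real"
  assumes g: "\<And>r. lo \<le> g r" "\<And>r. g r \<le> hi"
  shows "measure_pmf.expectation (run w A (Suc T) h) g = measure_pmf.expectation (A h) (\<lambda>d. case d of
     Compare S \<Rightarrow> measure_pmf.expectation (mnl_choice w S)
       (\<lambda>a. measure_pmf.expectation (run w A T (h @ [(S, a)])) g)
   | Output X \<Rightarrow> g (Some X))"
  unfolding run.simps expectation_bind_pmf[OF g]
  by (intro Bochner_Integration.integral_cong refl)
    (auto split: decision.split simp: expectation_bind_pmf[OF g])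

lemma expectation_run_0:
  fixes g :: "nat set option \<Rightarrow> real"
  assumes g: "\<And>r. lo \<le> g r" "\<And>r. g r \<le> hi"
  shows "measure_pmf.expectation (run w A 0 h) g = measure_pmf.expectation (A h) (\<lambda>d. case d of
     Compare S \<Rightarrow> g None | Output X \<Rightarrow> g (Some X))"
  unfolding run.simps expectation_bind_pmf[OF g]
  by (intro Bochner_Integration.integral_cong refl)
    (auto split: decision.split)

text \<open>The chain rule of relative entropy in variational form. Given the history, decisions
  have the same law under \<open>w\<close> and \<open>w'\<close>, so only the winners contribute,
  each round through \<open>step\<close>.\<close>

lemma run_ln_le:
  fixes G :: "nat set option \<Rightarrow> real"
  assumes A: "valid_algorithm n l A"
    and G: "\<And>r. 1 \<le> G r" "\<And>r. G r \<le> 3"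
    and c: "\<And>S a. 0 \<le> c S a" "\<And>S a. c S a \<le> 1"
    and step: "\<And>S F. S \<subseteq> {1..n} \<Longrightarrow> S \<noteq> {} \<Longrightarrow> (\<And>x. 1 \<le> F x) \<Longrightarrow> (\<And>x. F x \<le> 3) \<Longrightarrow>
      measure_pmf.expectation (mnl_choice w S) (\<lambda>x. ln (F x))
      \<le> ln (measure_pmf.expectation (mnl_choice w' S) F)
        + \<kappa> * measure_pmf.expectation (mnl_choice w S) (c S)"
  shows "measure_pmf.expectation (run w A T h) (\<lambda>r. ln (G r))
    \<le> ln (measure_pmf.expectation (run w' A T h) G) + \<kappa> * expected_cost w A c T h"
proof (induction T arbitrary: h)
  have lnG: "0 \<le> ln (G r)" "ln (G r) \<le> ln 3" for r
    using G[of r] by auto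
  {
    case 0
    \<comment> \<open>With no budget left the result depends on the decision alone, whose law does
      not involve the scores.\<close>
    have "measure_pmf.expectation (run w A 0 h) (\<lambda>r. ln (G r))
        = measure_pmf.expectation (A h) (\<lambda>d. ln (case d of Compare S \<Rightarrow> G None | Output X \<Rightarrow> G (Some X)))"
      unfolding expectation_run_0[of 0 "\<lambda>r. ln (G r)", OF lnG]
      by (intro Bochner_Integration.integral_cong refl) (auto split: decision.split)
    also have "\<dots> \<le> ln (measure_pmf.expectation (A h) (\<lambda>d. case d of Compare S \<Rightarrow> G None | Output X \<Rightarrow> G (Some X)))"
      using G by (intro expectation_ln_le[where hi = 3]) (auto split: decision.split)
    also have "\<dots> = ln (measure_pmf.expectation (run w' A 0 h) G)"
      unfolding expectation_run_0[of 1 G, OF G] ..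
    finally show ?case
      by simp
  next
    case (Suc T)
    define V where "V S a = measure_pmf.expectation (run w A T (h @ [(S, a)])) (\<lambda>r. ln (G r))" for S a
    define M where "M S a = measure_pmf.expectation (run w' A T (h @ [(S, a)])) G" for S a
    define N where "N S a = expected_cost w A c T (h @ [(S, a)])" for S a
    let ?E = "\<lambda>S. measure_pmf.expectation (mnl_choice w S)"
    let ?E' = "\<lambda>S. measure_pmf.expectation (mnl_choice w' S)"
    have V: "0 \<le> V S a" "V S a \<le> ln 3" for S a
      unfolding V_def using lnG by (auto intro!: expectation_pmf_bounds[where lo = 0 and hi = "ln 3"])
    have M: "1 \<le> M S a" "M S a \<le> 3" for S a
      unfolding M_def using G by (auto intro!: expectation_pmf_bounds[where lo = 1 and hi = 3])
    have N: "0 \<le> N S a" "N S a \<le> real T" for S a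
      unfolding N_def using expected_cost_bounds[of c, OF c] by auto
    have cN: "0 \<le> c S a + N S a" "c S a + N S a \<le> 1 + real T" for S a
      using c[of S a] N[of S a] by auto
    define m where "m d = (case d of Compare S \<Rightarrow> ?E' S (M S) | Output X \<Rightarrow> G (Some X))" for d
    define v where "v d = (case d of Compare S \<Rightarrow> ?E S (V S) | Output X \<Rightarrow> ln (G (Some X)))" for d
    define u where "u d = (case d of Compare S \<Rightarrow> ?E S (\<lambda>a. c S a + N S a) | Output X \<Rightarrow> 0)" for d
    have m: "1 \<le> m d" "m d \<le> 3" for d
      unfolding m_def using G M
      by (auto split: decision.split intro!: expectation_pmf_bounds[where lo = 1 and hi = 3])
    have v: "0 \<le> v d" "v d \<le> ln 3" for d
      unfolding v_def using lnG V
      by (auto split: decision.split intro!: expectation_pmf_bounds[where lo = 0 and hi = "ln 3"])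
    have u: "0 \<le> u d" "u d \<le> 1 + real T" for d
      unfolding u_def using cN
      by (auto split: decision.split intro!: expectation_pmf_bounds[where lo = 0 and hi = "1 + real T"])
    have lnm: "0 \<le> ln (m d)" "ln (m d) \<le> ln 3" for d
      using m[of d] by auto
    have vu: "v d \<le> ln (m d) + \<kappa> * u d" if d: "d \<in> set_pmf (A h)" for d
    proof (cases d)
      case (Compare S)
      then have "S \<subseteq> {1..n} \<and> 2 \<le> card S"
        using A d unfolding valid_algorithm_def by blast
      then have S: "S \<subseteq> {1..n}" "S \<noteq> {}"
        by auto
      have lnM: "0 \<le> ln (M S a)" "ln (M S a) \<le> ln 3" for a
        using M[of S a] by auto
      have int: "integrable (mnl_choice w S) (\<lambda>a. ln (M S a))" "integrable (mnl_choice w S) (V S)"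
          "integrable (mnl_choice w S) (N S)" "integrable (mnl_choice w S) (c S)"
        using lnM V N c by (auto intro!: integrable_pmf_bounded)
      \<comment> \<open>The induction hypothesis treats what follows each winner. Then
        \<open>step\<close> is used with \<open>F = M S\<close>, the expectation of \<open>G\<close>
        under \<open>w'\<close> given the winner; it inherits the bounds 1 and 3 from
        \<open>G\<close>.\<close>
      have "?E S (V S) \<le> ?E S (\<lambda>a. ln (M S a) + \<kappa> * N S a)"
      proof (rule integral_mono)
        show "V S a \<le> ln (M S a) + \<kappa> * N S a" for a
          unfolding V_def M_def N_def by (rule Suc.IH)
      qed (use int in auto)
      also have "\<dots> = ?E S (\<lambda>a. ln (M S a)) + \<kappa> * ?E S (N S)"
        using int by simp
      also have "?E S (\<lambda>a. ln (M S a)) \<le> ln (?E' S (M S)) + \<kappa> * ?E S (c S)"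
        by (rule step[OF S M])
      also have "ln (?E' S (M S)) + \<kappa> * ?E S (c S) + \<kappa> * ?E S (N S)
          = ln (?E' S (M S)) + \<kappa> * ?E S (\<lambda>a. c S a + N S a)"
        using int by (simp add: algebra_simps)
      finally show ?thesis
        using Compare by (simp add: v_def m_def u_def)
    qed (simp add: v_def m_def u_def)
    have int: "integrable (A h) v" "integrable (A h) (\<lambda>d. ln (m d))" "integrable (A h) u"
      using v lnm u by (auto intro!: integrable_pmf_bounded)
    have "measure_pmf.expectation (run w A (Suc T) h) (\<lambda>r. ln (G r)) = measure_pmf.expectation (A h) v"
      unfolding expectation_run_Suc[of 0 "\<lambda>r. ln (G r)", OF lnG] v_def V_def ..
    also have "\<dots> \<le> measure_pmf.expectation (A h) (\<lambda>d. ln (m d) + \<kappa> * u d)"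
      using int vu by (intro integral_mono_AE) (auto simp: AE_measure_pmf_iff)
    also have "\<dots> = measure_pmf.expectation (A h) (\<lambda>d. ln (m d)) + \<kappa> * measure_pmf.expectation (A h) u"
      using int by simp
    also have "measure_pmf.expectation (A h) (\<lambda>d. ln (m d)) \<le> ln (measure_pmf.expectation (A h) m)"
      using m by (rule expectation_ln_le)
    also have "measure_pmf.expectation (A h) m = measure_pmf.expectation (run w' A (Suc T) h) G"
      unfolding expectation_run_Suc[of 1 G, OF G] m_def M_def ..
    also have "measure_pmf.expectation (A h) u = expected_cost w A c (Suc T) h"
      unfolding u_def N_def by simp
    finally show ?case
      by simp
  }
qed

text \<open>By linearity of expectation, a bound \<open>B\<close> on the joint charge of all
  \<open>i\<close> in any single round gives \<open>B\<close> times the number of rounds, however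
  the sets were chosen.\<close>

lemma sum_expected_cost_le:
  assumes A: "valid_algorithm n l A"
    and c: "\<And>i S a. 0 \<le> c i S a" "\<And>i S a. c i S a \<le> 1"
    and B: "0 \<le> B" "\<And>S a. card S \<le> l \<Longrightarrow> S \<subseteq> {1..n} \<Longrightarrow> (\<Sum>i\<in>I. c i S a) \<le> B"
  shows "(\<Sum>i\<in>I. expected_cost w A (c i) T h) \<le> B * real T"
proof (induction T arbitrary: h)
  case (Suc T)
  define N where "N i S a = expected_cost w A (c i) T (h @ [(S, a)])" for i S a
  let ?E = "\<lambda>S. measure_pmf.expectation (mnl_choice w S)"
  define u where "u i d = (case d of Compare S \<Rightarrow> ?E S (\<lambda>a. c i S a + N i S a) | Output X \<Rightarrow> 0)" for i d
  have N: "0 \<le> N i S a" "N i S a \<le> real T" for i S a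
    unfolding N_def using expected_cost_bounds[of "c i", OF c] by auto
  have cN: "0 \<le> c i S a + N i S a" "c i S a + N i S a \<le> 1 + real T" for i S a
    using c[of i S a] N[of i S a] by auto
  have u: "0 \<le> u i d" "u i d \<le> 1 + real T" for i d
    unfolding u_def using cN
    by (auto split: decision.split intro!: expectation_pmf_bounds[where lo = 0 and hi = "1 + real T"])
  have int: "integrable (A h) (u i)" for i
    using u by (rule integrable_pmf_bounded)
  have sum_u: "(\<Sum>i\<in>I. u i d) \<le> B * real (Suc T)" if d: "d \<in> set_pmf (A h)" for d
  proof (cases d)
    case (Compare S)
    then have S: "S \<subseteq> {1..n}" "card S \<le> l"
      using A d by (auto simp: valid_algorithm_def)
    have int: "integrable (mnl_choice w S) (\<lambda>a. c i S a + N i S a)" for i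
      using cN by (rule integrable_pmf_bounded)
    have "(\<Sum>i\<in>I. u i d) = ?E S (\<lambda>a. \<Sum>i\<in>I. c i S a + N i S a)"
      using int Compare by (simp add: u_def)
    also have "\<dots> \<le> B * real (Suc T)"
    proof (rule measure_pmf.integral_le_const)
      show "AE a in mnl_choice w S. (\<Sum>i\<in>I. c i S a + N i S a) \<le> B * real (Suc T)"
      proof (rule AE_I2)
        fix a
        show "(\<Sum>i\<in>I. c i S a + N i S a) \<le> B * real (Suc T)"
          using B(2)[OF S(2,1), of a] Suc.IH[of "h @ [(S, a)]"]
          by (simp add: sum.distrib N_def algebra_simps)
      qed
    qed (use int in auto)
    finally show ?thesis .
  qed (use B in \<open>simp add: u_def\<close>)
  have "expected_cost w A (c i) (Suc T) h = measure_pmf.expectation (A h) (u i)" for i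
    unfolding u_def N_def by simp
  then have "(\<Sum>i\<in>I. expected_cost w A (c i) (Suc T) h) = measure_pmf.expectation (A h) (\<lambda>d. \<Sum>i\<in>I. u i d)"
    using int by (simp only: Bochner_Integration.integral_sum)
  also have "\<dots> \<le> B * real (Suc T)"
    using int sum_u by (intro measure_pmf.integral_le_const) (auto simp: AE_measure_pmf_iff)
  finally show ?case .
qed simp


section \<open>Items and their partners across the boundary\<close>

text \<open>On the other side of the boundary, this is the item whose score is nearest to that of
  \<open>i\<close>, so the change of score is as small as possible.\<close>

definition partner :: "nat \<Rightarrow> nat \<Rightarrow> nat" where
  "partner k i = (if i \<le> k then k + 1 else k)"

text \<open>Both labels are tested, since this makes the events for \<pi> and for \<pi> with the two
  labels swapped disjoint. \<open>None\<close> never counts as separating.\<close>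

definition separates :: "nat \<Rightarrow> nat \<Rightarrow> (nat \<Rightarrow> nat) \<Rightarrow> nat set option set" where
  "separates k i \<pi> =
     Some ` {X. (\<pi> i \<in> X \<longleftrightarrow> i \<le> k) \<and> (\<pi> (partner k i) \<in> X \<longleftrightarrow> \<not> i \<le> k)}"

abbreviation score :: "(nat \<Rightarrow> real) \<Rightarrow> (nat \<Rightarrow> nat) \<Rightarrow> nat \<Rightarrow> real" where
  "score \<theta> \<pi> \<equiv> (\<lambda>a. \<theta> (inv \<pi> a))"

abbreviation perturbed :: "nat \<Rightarrow> (nat \<Rightarrow> real) \<Rightarrow> nat \<Rightarrow> (nat \<Rightarrow> nat) \<Rightarrow> nat \<Rightarrow> real" where
  "perturbed k \<theta> i \<pi> \<equiv> (score \<theta> \<pi>)(\<pi> i := \<theta> (partner k i))"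

text \<open>After the perturbation both labels have the score of the partner, so the scores no
  longer reveal which of them belongs to \<open>i\<close>.\<close>

lemma perturbed_swap:
  assumes \<pi>: "bij \<pi>"
  shows "perturbed k \<theta> i (\<pi> \<circ> Transposition.transpose i (partner k i)) = perturbed k \<theta> i \<pi>"
proof
  fix a
  let ?j = "partner k i"
  have inv: "inv (\<pi> \<circ> Transposition.transpose i ?j) = Transposition.transpose i ?j \<circ> inv \<pi>"
    using \<pi> by (simp add: o_inv_distrib)
  have "a = \<pi> x \<longleftrightarrow> inv \<pi> a = x" for x
    using \<pi> by (metis bij_inv_eq_iff)
  then show "perturbed k \<theta> i (\<pi> \<circ> Transposition.transpose i ?j) a = perturbed k \<theta> i \<pi> a"
    by (auto simp: inv Transposition.transpose_def)
qed

text \<open>The run has the same law for \<pi> and for \<pi> with the two labels swapped, while the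
  two separating events are disjoint. Swapping permutes the permutations, so the sum over all \<pi>
  counts each term twice.\<close>

lemma sum_prob_perturbed_le:
  assumes k: "1 \<le> k" "k < n" and i: "i \<in> {1..n}"
  shows "2 * (\<Sum>\<pi> | \<pi> permutes {1..n}.
      measure_pmf.prob (run (perturbed k \<theta> i \<pi>) A T []) (separates k i \<pi>))
    \<le> card {\<pi>. \<pi> permutes {1..n}}"
proof -
  let ?t = "Transposition.transpose i (partner k i)"
  let ?f = "\<lambda>\<pi>. measure_pmf.prob (run (perturbed k \<theta> i \<pi>) A T []) (separates k i \<pi>)"
  have t: "?t permutes {1..n}"
    using k i by (intro permutes_swap_id) (auto simp: partner_def)
  have "?f \<pi> + ?f (\<pi> \<circ> ?t) \<le> 1" if \<pi>: "\<pi> permutes {1..n}" for \<pi>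
  proof -
    have "?f (\<pi> \<circ> ?t) = measure_pmf.prob (run (perturbed k \<theta> i \<pi>) A T []) (separates k i (\<pi> \<circ> ?t))"
      by (simp only: perturbed_swap[OF permutes_bij[OF \<pi>]])
    moreover have "separates k i \<pi> \<inter> separates k i (\<pi> \<circ> ?t) = {}"
      by (auto simp: separates_def)
    ultimately show ?thesis
      by (simp flip: measure_pmf.finite_measure_Union)
  qed
  then have "(\<Sum>\<pi> | \<pi> permutes {1..n}. ?f \<pi> + ?f (\<pi> \<circ> ?t)) \<le> (\<Sum>\<pi> | \<pi> permutes {1..n}. 1)"
    by (intro sum_mono) auto
  then show ?thesis
    using sum_permutations_compose_right[OF t, of ?f] by (simp add: sum.distrib)
qed

section \<open>From success to a cost for each item\<close>

lemma success_prob_eq: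
  "success_prob n k \<theta> A T = (\<Sum>\<pi> | \<pi> permutes {1..n}.
     measure_pmf.prob (run (score \<theta> \<pi>) A T []) {Some (\<pi> ` {1..k})}) / card {\<pi>. \<pi> permutes {1..n}}"
proof -
  let ?P = "{\<pi>. \<pi> permutes {1..n}}"
  have P: "finite ?P" "?P \<noteq> {}"
    by (auto simp: finite_permutations intro: permutes_id)
  let ?g = "\<lambda>x. indicator {(\<pi>, r). r = Some (\<pi> ` {1..k})} x :: real"
  have g: "0 \<le> ?g x" "?g x \<le> 1" for x :: "(nat \<Rightarrow> nat) \<times> nat set option"
    by (auto split: split_indicator)
  have "success_prob n k \<theta> A T = measure_pmf.expectation (topk_experiment n \<theta> A T) ?g"
    by (simp add: success_prob_def)
  also have "\<dots> = (\<Sum>\<pi>\<in>?P. measure_pmf.expectation (run (score \<theta> \<pi>) A T []) (\<lambda>r. ?g (\<pi>, r))) / card ?P"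
    unfolding topk_experiment_def expectation_bind_pmf[OF g] integral_pmf_of_set[OF P(2,1)]
    by simp
  finally have eq: "success_prob n k \<theta> A T = \<dots>" .
  have ind: "(\<lambda>r. ?g (\<pi>, r)) = indicator {Some (\<pi> ` {1..k})}" for \<pi>
    by (auto simp: indicator_def)
  show ?thesis
    unfolding eq ind by simp
qed

text \<open>The correct output separates every item from its partner.\<close>

lemma sum_prob_separates_ge:
  assumes k: "1 \<le> k" "k < n" and i: "i \<in> {1..n}"
    and succ: "7 / 8 \<le> success_prob n k \<theta> A T"
  shows "7 / 8 * card {\<pi>. \<pi> permutes {1..n}} \<le> (\<Sum>\<pi> | \<pi> permutes {1..n}.
      measure_pmf.prob (run (score \<theta> \<pi>) A T []) (separates k i \<pi>))"
proof -
  let ?P = "{\<pi>. \<pi> permutes {1..n}}"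
  have P: "finite ?P" "?P \<noteq> {}"
    by (auto simp: finite_permutations intro: permutes_id)
  then have "0 < real (card ?P)"
    by (simp add: card_gt_0_iff)
  then have "7 / 8 * card ?P
      \<le> (\<Sum>\<pi>\<in>?P. measure_pmf.prob (run (score \<theta> \<pi>) A T []) {Some (\<pi> ` {1..k})})"
    using succ by (simp add: success_prob_eq field_simps)
  also have "\<dots> \<le> (\<Sum>\<pi>\<in>?P. measure_pmf.prob (run (score \<theta> \<pi>) A T []) (separates k i \<pi>))"
  proof (intro sum_mono measure_pmf.finite_measure_mono)
    fix \<pi> assume "\<pi> \<in> ?P"
    then have "inj \<pi>"
      by (auto intro: permutes_inj)
    then show "{Some (\<pi> ` {1..k})} \<subseteq> separates k i \<pi>"
      using k i by (auto simp: separates_def partner_def inj_image_mem_iff)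
  qed simp
  finally show ?thesis .
qed

text \<open>The separating event has average probability at least 7/8 under the true scores and at
  most 1/2 under the perturbed ones; \<open>run_ln_le\<close> turns this difference into a
  cost.\<close>

lemma sum_expected_cost_ge:
  assumes A: "valid_algorithm n l A" and k: "1 \<le> k" "k < n" and i: "i \<in> {1..n}"
    and succ: "7 / 8 \<le> success_prob n k \<theta> A T"
    and c: "\<And>\<pi> S a. 0 \<le> c \<pi> S a" "\<And>\<pi> S a. c \<pi> S a \<le> 1"
    and step: "\<And>\<pi> S F. \<pi> permutes {1..n} \<Longrightarrow> S \<subseteq> {1..n} \<Longrightarrow> S \<noteq> {} \<Longrightarrow>
      (\<And>x. 1 \<le> F x) \<Longrightarrow> (\<And>x. F x \<le> 3) \<Longrightarrow>
      measure_pmf.expectation (mnl_choice (score \<theta> \<pi>) S) (\<lambda>x. ln (F x))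
      \<le> ln (measure_pmf.expectation (mnl_choice (perturbed k \<theta> i \<pi>) S) F)
        + \<kappa> * measure_pmf.expectation (mnl_choice (score \<theta> \<pi>) S) (c \<pi> S)"
  shows "card {\<pi>. \<pi> permutes {1..n}} / 8
    \<le> \<kappa> * (\<Sum>\<pi> | \<pi> permutes {1..n}. expected_cost (score \<theta> \<pi>) A (c \<pi>) T [])"
proof -
  let ?P = "{\<pi>. \<pi> permutes {1..n}}"
  define p where "p \<pi> = measure_pmf.prob (run (score \<theta> \<pi>) A T []) (separates k i \<pi>)" for \<pi>
  define q where "q \<pi> = measure_pmf.prob (run (perturbed k \<theta> i \<pi>) A T []) (separates k i \<pi>)" for \<pi>
  define C where "C \<pi> = expected_cost (score \<theta> \<pi>) A (c \<pi>) T []" for \<pi>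
  have *: "ln 3 * p \<pi> \<le> ln 2 + q \<pi> - 1 / 2 + \<kappa> * C \<pi>" if \<pi>: "\<pi> \<in> ?P" for \<pi>
  proof -
    \<comment> \<open>The exponential of \<open>ln 3\<close> times the indicator. The value 3 is
      large enough to make \<open>7 / 8 * ln 3 - ln 2\<close> positive below.\<close>
    define G :: "nat set option \<Rightarrow> real" where "G r = 1 + 2 * indicator (separates k i \<pi>) r" for r
    have G: "1 \<le> G r" "G r \<le> 3" for r
      by (auto simp: G_def split: split_indicator)
    have lnG: "(\<lambda>r. ln (G r)) = (\<lambda>r. ln 3 * indicator (separates k i \<pi>) r)"
      by (auto simp: G_def split: split_indicator)
    have "integrable (run (perturbed k \<theta> i \<pi>) A T []) (indicator (separates k i \<pi>) :: _ \<Rightarrow> real)"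
      by (rule integrable_pmf_bounded[of 0 _ 1]) (auto split: split_indicator)
    then have EG: "measure_pmf.expectation (run (perturbed k \<theta> i \<pi>) A T []) G = 1 + 2 * q \<pi>"
      unfolding G_def q_def by simp
    have q: "0 < 1 + 2 * q \<pi>"
      by (simp add: q_def add_pos_nonneg)
    have "ln 3 * p \<pi> = measure_pmf.expectation (run (score \<theta> \<pi>) A T []) (\<lambda>r. ln (G r))"
      by (simp add: lnG p_def)
    also have "\<dots> \<le> ln (measure_pmf.expectation (run (perturbed k \<theta> i \<pi>) A T []) G) + \<kappa> * C \<pi>"
      unfolding C_def using A G c \<pi> by (intro run_ln_le step) auto
    also have "\<dots> = ln (1 + 2 * q \<pi>) + \<kappa> * C \<pi>"
      by (simp add: EG)
    \<comment> \<open>The tangent of the logarithm at \<open>q \<pi> = 1 / 2\<close>, the bound on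
      the average of \<open>q\<close>. Being linear, it can be summed over \<pi>.\<close>
    also have "ln (1 + 2 * q \<pi>) = ln 2 + ln ((1 + 2 * q \<pi>) / 2)"
      using q by (simp add: ln_div)
    also have "ln ((1 + 2 * q \<pi>) / 2) \<le> (1 + 2 * q \<pi>) / 2 - 1"
      using q by (intro ln_le_minus_one) simp
    finally show ?thesis
      by (simp add: field_simps)
  qed
  have "ln 3 * (7 / 8 * card ?P) \<le> ln 3 * (\<Sum>\<pi>\<in>?P. p \<pi>)"
    unfolding p_def using sum_prob_separates_ge[OF k i succ] by (intro mult_left_mono) auto
  also have "\<dots> \<le> (\<Sum>\<pi>\<in>?P. ln 2 + q \<pi> - 1 / 2 + \<kappa> * C \<pi>)"
    unfolding sum_distrib_left using * by (rule sum_mono)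
  also have "\<dots> = (ln 2 - 1 / 2) * card ?P + (\<Sum>\<pi>\<in>?P. q \<pi>) + \<kappa> * (\<Sum>\<pi>\<in>?P. C \<pi>)"
    by (simp add: sum.distrib sum_subtractf sum_distrib_left algebra_simps)
  also have "(\<Sum>\<pi>\<in>?P. q \<pi>) \<le> 1 / 2 * card ?P"
    unfolding q_def using sum_prob_perturbed_le[OF k i, of \<theta> A T] by simp
  finally have "(7 / 8 * ln 3 - ln 2) * card ?P \<le> \<kappa> * (\<Sum>\<pi>\<in>?P. C \<pi>)"
    by (simp add: algebra_simps)
  \<comment> \<open>Multiplied by 8 and exponentiated, this reads
    \<open>exp 1 * 2 ^ 8 \<le> 3 ^ 7\<close>, which follows from
    \<open>exp 1 \<le> 3\<close>.\<close>
  moreover have "(1 :: real) / 8 \<le> 7 / 8 * ln 3 - ln 2"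
  proof -
    have "exp 1 * (2 :: real) ^ 8 \<le> 3 * 2 ^ 8"
      using exp_le by (intro mult_right_mono) auto
    also have "\<dots> \<le> 3 ^ 7"
      by simp
    finally have "ln (exp 1 * (2 :: real) ^ 8) \<le> ln (3 ^ 7)"
      by (subst ln_le_cancel_iff) auto
    then show ?thesis
      using ln_realpow[of "2 :: real" 8] ln_realpow[of "3 :: real" 7] by (simp add: ln_mult)
  qed
  then have "1 / 8 * real (card ?P) \<le> (7 / 8 * ln 3 - ln 2) * card ?P"
    by (intro mult_right_mono) auto
  ultimately show ?thesis
    by (simp add: C_def)
qed

section \<open>Summing the costs over the items\<close>

theorem theorem2:
  "\<exists>c::real. c > 0 \<and> (\<forall>(n::nat) (k::nat) (l::nat) (\<theta> :: nat \<Rightarrow> real) (A :: algorithm) (T::nat).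
     topk_instance n k \<theta> \<longrightarrow> 2 \<le> l \<longrightarrow> valid_algorithm n l A \<longrightarrow>
     success_prob n k \<theta> A T \<ge> 7 / 8 \<longrightarrow>
     real T \<ge> c * (real n / real l + real k
       + (\<Sum>i=k+1..n. \<theta> i) / \<theta> k
       + (\<Sum>i | i \<in> {k+1..n} \<and> \<theta> i \<ge> \<theta> k / 2. (\<theta> k)\<^sup>2 / (\<theta> k - \<theta> i)\<^sup>2)
       + (\<Sum>i | i \<in> {1..k} \<and> \<theta> i \<le> 2 * \<theta> (k+1). (\<theta> (k+1))\<^sup>2 / (\<theta> (k+1) - \<theta> i)\<^sup>2)))"
\<comment> \<open>The five terms are bounded by 16, 24, 8, 16 and 8 times \<open>T\<close>, and
  these constants add up to 72.\<close>
proof (intro exI[of _ "1 / 72"] conjI allI impI)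
  fix n k l :: nat and \<theta> :: "nat \<Rightarrow> real" and A :: algorithm and T :: nat
  assume inst: "topk_instance n k \<theta>" and l: "2 \<le> l" and A: "valid_algorithm n l A"
    and succ: "success_prob n k \<theta> A T \<ge> 7 / 8"
  have k: "1 \<le> k" "k < n" and pos: "\<And>i. i \<in> {1..n} \<Longrightarrow> \<theta> i > 0"
    and mono: "\<And>i j. i \<in> {1..n} \<Longrightarrow> j \<in> {1..n} \<Longrightarrow> i \<le> j \<Longrightarrow> \<theta> j \<le> \<theta> i"
    and gap: "\<theta> k > \<theta> (k + 1)"
    using inst by (auto simp: topk_instance_def)
  have posk: "\<theta> k > 0" "\<theta> (k + 1) > 0"
    using k by (auto intro!: pos)
  let ?P = "{\<pi>. \<pi> permutes {1..n}}"
  define N where "N = real (card ?P)"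
  have "finite ?P" "?P \<noteq> {}"
    by (auto simp: finite_permutations intro: permutes_id)
  then have N: "0 < N"
    by (simp add: N_def card_gt_0_iff)
  \<comment> \<open>Up to the factor \<open>N\<close>, \<open>W i\<close> is the expected number of
    rounds won by item \<open>i\<close> and \<open>I i\<close> the expected number of rounds in
    which it takes part, both under the true scores.\<close>
  define W where "W i = (\<Sum>\<pi>\<in>?P. expected_cost (score \<theta> \<pi>) A (\<lambda>S a. of_bool (a = \<pi> i)) T [])" for i
  define I where "I i = (\<Sum>\<pi>\<in>?P. expected_cost (score \<theta> \<pi>) A (\<lambda>S a. of_bool (\<pi> i \<in> S)) T [])" for i

  have inv_\<pi>: "inv \<pi> (\<pi> i) = i" if "\<pi> permutes {1..n}" for \<pi> i
    using that by (simp add: permutes_inverses)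
  have score_pos: "score \<theta> \<pi> x > 0" if "\<pi> permutes {1..n}" "x \<in> {1..n}" for \<pi> x
    using that by (intro pos) (metis permutes_in_image permutes_inv)
  have partner: "partner k i \<in> {1..n}" for i
    using k by (auto simp: partner_def)

  have W0: "0 \<le> W i" for i
    unfolding W_def by (intro sum_nonneg) (simp add: expected_cost_bounds)
  \<comment> \<open>Each round has one winner, so at most one item is charged.\<close>
  have W_sum: "(\<Sum>i=1..n. W i) \<le> N * T"
  proof -
    have "(\<Sum>i=1..n. W i)
        = (\<Sum>\<pi>\<in>?P. \<Sum>i=1..n. expected_cost (score \<theta> \<pi>) A (\<lambda>S a. of_bool (a = \<pi> i)) T [])"
      unfolding W_def by (rule sum.swap)
    also have "\<dots> \<le> (\<Sum>\<pi>\<in>?P. 1 * real T)"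
    proof (intro sum_mono sum_expected_cost_le[OF A])
      fix \<pi> S and a :: nat assume "\<pi> \<in> ?P"
      then have "a = \<pi> i \<longleftrightarrow> i = inv \<pi> a" for i
        using permutes_inv_eq[of \<pi> "{1..n}" a i] by auto
      then have "of_bool (a = \<pi> i) = (if i = inv \<pi> a then 1 else 0 :: real)" for i
        by simp
      then show "(\<Sum>i=1..n. of_bool (a = \<pi> i)) \<le> (1 :: real)"
        by (simp add: sum.delta)
    qed auto
    finally show ?thesis
      by (simp add: N_def)
  qed
  \<comment> \<open>Each round charges the items in its set, at most \<open>l\<close> of
    them.\<close>
  have I_sum: "(\<Sum>i=1..n. I i) \<le> N * (l * T)"
  proof -
    have "(\<Sum>i=1..n. I i)
        = (\<Sum>\<pi>\<in>?P. \<Sum>i=1..n. expected_cost (score \<theta> \<pi>) A (\<lambda>S a. of_bool (\<pi> i \<in> S)) T [])"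
      unfolding I_def by (rule sum.swap)
    also have "\<dots> \<le> (\<Sum>\<pi>\<in>?P. real l * real T)"
    proof (intro sum_mono sum_expected_cost_le[OF A])
      fix \<pi> S assume \<pi>: "\<pi> \<in> ?P" and S: "card S \<le> l" "S \<subseteq> {1..n}"
      have "(\<Sum>i=1..n. of_bool (\<pi> i \<in> S)) = (\<Sum>i=1..n. of_bool (i \<in> S) :: real)"
        using \<pi> by (intro sum.permute[of \<pi> _ "\<lambda>i. of_bool (i \<in> S)", unfolded o_def, symmetric]) simp
      also have "\<dots> = card S"
        using S by (simp add: sum.If_cases of_bool_def Int_absorb1)
      finally show "(\<Sum>i=1..n. of_bool (\<pi> i \<in> S)) \<le> real l"
        using S by simp
    qed auto
    finally show ?thesis
      by (simp add: N_def)
  qed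

  have I_ge: "N / 8 \<le> 2 * I i" if i: "i \<in> {1..n}" for i
    unfolding N_def I_def
  proof (rule sum_expected_cost_ge[OF A k i succ])
    fix \<pi> S and F :: "nat \<Rightarrow> real"
    assume F: "\<And>x. 1 \<le> F x" "\<And>x. F x \<le> 3"
    show "measure_pmf.expectation (mnl_choice (score \<theta> \<pi>) S) (\<lambda>x. ln (F x))
      \<le> ln (measure_pmf.expectation (mnl_choice (perturbed k \<theta> i \<pi>) S) F)
        + 2 * measure_pmf.expectation (mnl_choice (score \<theta> \<pi>) S) (\<lambda>_. of_bool (\<pi> i \<in> S))"
      using F by (rule mnl_choice_step_member)
  qed auto
  have W_ge: "N / 8 \<le> 3 * W i" if i: "i \<in> {1..k}" for i
  proof -
    have "\<theta> (partner k i) \<le> \<theta> i"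
      using i k by (auto simp: partner_def intro!: mono)
    then have le: "\<theta> (partner k i) \<le> score \<theta> \<pi> (\<pi> i)" if "\<pi> permutes {1..n}" for \<pi>
      by (simp add: inv_\<pi>[OF that])
    have "i \<in> {1..n}"
      using i k by auto
    then show ?thesis
      unfolding N_def W_def
    proof (rule sum_expected_cost_ge[OF A k _ succ])
      fix \<pi> S and F :: "nat \<Rightarrow> real"
      assume \<pi>: "\<pi> permutes {1..n}" and S: "S \<subseteq> {1..n}" "S \<noteq> {}"
        and F: "\<And>x. 1 \<le> F x" "\<And>x. F x \<le> 3"
      show "measure_pmf.expectation (mnl_choice (score \<theta> \<pi>) S) (\<lambda>x. ln (F x))
        \<le> ln (measure_pmf.expectation (mnl_choice (perturbed k \<theta> i \<pi>) S) F)
          + 3 * measure_pmf.expectation (mnl_choice (score \<theta> \<pi>) S) (\<lambda>a. of_bool (a = \<pi> i))"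
        using S by (intro mnl_choice_step_win le[OF \<pi>] F score_pos[OF \<pi>] pos[OF partner])
          (auto intro: finite_subset)
    qed auto
  qed
  have W_ge': "N / 8 \<le> (\<theta> (partner k i) - \<theta> i)\<^sup>2 / (\<theta> (partner k i) * \<theta> i) * W i"
    if i: "i \<in> {1..n}" for i
    unfolding N_def W_def
  proof (rule sum_expected_cost_ge[OF A k i succ])
    fix \<pi> S and F :: "nat \<Rightarrow> real"
    assume \<pi>: "\<pi> permutes {1..n}" and S: "S \<subseteq> {1..n}" "S \<noteq> {}" and F: "\<And>x. 1 \<le> F x"
    show "measure_pmf.expectation (mnl_choice (score \<theta> \<pi>) S) (\<lambda>x. ln (F x))
      \<le> ln (measure_pmf.expectation (mnl_choice (perturbed k \<theta> i \<pi>) S) F)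
        + (\<theta> (partner k i) - \<theta> i)\<^sup>2 / (\<theta> (partner k i) * \<theta> i)
          * measure_pmf.expectation (mnl_choice (score \<theta> \<pi>) S) (\<lambda>a. of_bool (a = \<pi> i))"
    proof -
      have "finite S" "0 < score \<theta> \<pi> (\<pi> i)" "\<And>x. x \<in> S \<Longrightarrow> 0 < score \<theta> \<pi> x"
        using S pos[OF i] score_pos[OF \<pi>] by (auto simp: inv_\<pi>[OF \<pi>] intro: finite_subset)
      from mnl_choice_step_kl[where w = "score \<theta> \<pi>" and b = "\<pi> i" and F = F,
          OF this(1) S(2) this(3,2) pos[OF partner] F] show ?thesis
        unfolding inv_\<pi>[OF \<pi>] .
    qed
  qed auto

  have W_ge'': "N / 8 \<le> \<kappa> * W i"
    if \<kappa>: "(\<theta> j - \<theta> i)\<^sup>2 / (\<theta> j * \<theta> i) \<le> \<kappa>" and i: "i \<in> {1..n}" "partner k i = j"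
    for i j \<kappa>
    using order_trans[OF W_ge'[OF i(1), unfolded i(2)] mult_right_mono[OF \<kappa> W0[of i]]] .

  \<comment> \<open>If each term \<open>r i\<close> is paid for by \<open>C\<close> times the wins
    of item \<open>i\<close>, the sum is at most \<open>C * T\<close>. All terms but
    \<open>n / l\<close> are obtained this way.\<close>
  have sum_le: "(\<Sum>i\<in>J. r i) \<le> C * T"
    if J: "J \<subseteq> {1..n}" and C: "0 \<le> C" and r: "\<And>i. i \<in> J \<Longrightarrow> r i * N \<le> C * W i"
    for J and r :: "nat \<Rightarrow> real" and C :: real
  proof -
    have "(\<Sum>i\<in>J. r i) * N \<le> C * (\<Sum>i\<in>J. W i)"
      unfolding sum_distrib_left sum_distrib_right using r by (rule sum_mono)
    also have "(\<Sum>i\<in>J. W i) \<le> (\<Sum>i=1..n. W i)"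
      using J W0 by (intro sum_mono2) auto
    also note W_sum
    finally show ?thesis
      using C N by (simp add: mult_left_mono)
  qed

  have "real n * (N / 8) \<le> (\<Sum>i=1..n. 2 * I i)"
    using sum_mono[of "{1..n}" "\<lambda>_. N / 8", OF I_ge] by simp
  also have "\<dots> \<le> 2 * (N * (l * T))"
    using I_sum by (simp flip: sum_distrib_left)
  finally have "real n \<le> 16 * (l * T)"
    using N by (simp add: field_simps)
  then have b1: "real n / l \<le> 16 * T"
    using l by (simp add: field_simps)

  have "(\<Sum>i=1..k. 1) \<le> 24 * real T"
    using k by (intro sum_le) (use W_ge in force)+
  then have b2: "real k \<le> 24 * T"
    by simp

  have "(\<Sum>i=k+1..n. \<theta> i / \<theta> k) \<le> 8 * real T"
  proof (rule sum_le)
    fix i assume i: "i \<in> {k+1..n}"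
    then have pi: "\<theta> i > 0" and d: "\<theta> i \<le> \<theta> k"
      using k by (auto intro!: pos mono)
    \<comment> \<open>Bounding the difference by \<open>\<theta> k\<close> reduces the cost factor
      to \<open>\<theta> k / \<theta> i\<close>, the reciprocal of the wanted term.\<close>
    have "(\<theta> k - \<theta> i)\<^sup>2 \<le> (\<theta> k)\<^sup>2"
      using pi d by (intro power_mono) auto
    then have "(\<theta> k - \<theta> i)\<^sup>2 / (\<theta> k * \<theta> i) \<le> (\<theta> k)\<^sup>2 / (\<theta> k * \<theta> i)"
      using pi posk by (intro divide_right_mono) auto
    then have "N / 8 \<le> (\<theta> k)\<^sup>2 / (\<theta> k * \<theta> i) * W i"
      by (rule W_ge'') (use i in \<open>auto simp: partner_def\<close>)
    then show "\<theta> i / \<theta> k * N \<le> 8 * W i"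
      using pi posk by (simp add: field_simps power2_eq_square)
  qed auto
  then have b3: "(\<Sum>i=k+1..n. \<theta> i) / \<theta> k \<le> 8 * T"
    by (simp add: sum_divide_distrib)

  have b4: "(\<Sum>i | i \<in> {k+1..n} \<and> \<theta> i \<ge> \<theta> k / 2. (\<theta> k)\<^sup>2 / (\<theta> k - \<theta> i)\<^sup>2) \<le> 16 * real T"
  proof (rule sum_le)
    fix i assume "i \<in> {i. i \<in> {k+1..n} \<and> \<theta> i \<ge> \<theta> k / 2}"
    then have i: "i \<in> {k+1..n}" and half: "\<theta> k / 2 \<le> \<theta> i"
      by auto
    have "\<theta> i \<le> \<theta> (k + 1)"
      using i k by (intro mono) auto
    \<comment> \<open>The strict gap at the boundary keeps the denominator of the term
      nonzero.\<close>
    then have d: "\<theta> i < \<theta> k"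
      using gap by simp
    have pi: "\<theta> i > 0"
      using i by (intro pos) auto
    \<comment> \<open>The restriction to scores of at least \<open>\<theta> k / 2\<close> replaces
      the product by a square at the price of a factor 2, hence 16 instead of 8.\<close>
    have "(\<theta> k)\<^sup>2 \<le> 2 * (\<theta> k * \<theta> i)"
      using half posk by (simp add: power2_eq_square)
    then have "(\<theta> k - \<theta> i)\<^sup>2 / (\<theta> k * \<theta> i) \<le> (\<theta> k - \<theta> i)\<^sup>2 / ((\<theta> k)\<^sup>2 / 2)"
      using pi posk by (intro divide_left_mono) auto
    then have "N / 8 \<le> (\<theta> k - \<theta> i)\<^sup>2 / ((\<theta> k)\<^sup>2 / 2) * W i"
      by (rule W_ge'') (use i in \<open>auto simp: partner_def\<close>)
    then show "(\<theta> k)\<^sup>2 / (\<theta> k - \<theta> i)\<^sup>2 * N \<le> 16 * W i"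
      using d posk by (simp add: field_simps)
  qed auto

  have b5: "(\<Sum>i | i \<in> {1..k} \<and> \<theta> i \<le> 2 * \<theta> (k+1). (\<theta> (k+1))\<^sup>2 / (\<theta> (k+1) - \<theta> i)\<^sup>2) \<le> 8 * real T"
  proof (rule sum_le)
    fix i assume "i \<in> {i. i \<in> {1..k} \<and> \<theta> i \<le> 2 * \<theta> (k+1)}"
    then have i: "i \<in> {1..k}"
      by auto
    have "\<theta> k \<le> \<theta> i"
      using i k by (intro mono) auto
    then have d: "\<theta> (k + 1) < \<theta> i"
      using gap by simp
    \<comment> \<open>Here item \<open>i\<close> has the larger score, so the product is at least
      the square and the constant stays 8.\<close>
    have "(\<theta> (k+1))\<^sup>2 \<le> \<theta> (k+1) * \<theta> i"
      using d posk by (simp add: power2_eq_square)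
    then have "(\<theta> (k+1) - \<theta> i)\<^sup>2 / (\<theta> (k+1) * \<theta> i) \<le> (\<theta> (k+1) - \<theta> i)\<^sup>2 / (\<theta> (k+1))\<^sup>2"
      using d posk by (intro divide_left_mono) auto
    then have "N / 8 \<le> (\<theta> (k+1) - \<theta> i)\<^sup>2 / (\<theta> (k+1))\<^sup>2 * W i"
      by (rule W_ge'') (use i k in \<open>auto simp: partner_def\<close>)
    then show "(\<theta> (k+1))\<^sup>2 / (\<theta> (k+1) - \<theta> i)\<^sup>2 * N \<le> 8 * W i"
      using d posk by (simp add: field_simps)
  qed (use k in auto)

  show "real T \<ge> 1 / 72 * (real n / real l + real k
       + (\<Sum>i=k+1..n. \<theta> i) / \<theta> k
       + (\<Sum>i | i \<in> {k+1..n} \<and> \<theta> i \<ge> \<theta> k / 2. (\<theta> k)\<^sup>2 / (\<theta> k - \<theta> i)\<^sup>2)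
       + (\<Sum>i | i \<in> {1..k} \<and> \<theta> i \<le> 2 * \<theta> (k+1). (\<theta> (k+1))\<^sup>2 / (\<theta> (k+1) - \<theta> i)\<^sup>2))"
    using b1 b2 b3 b4 b5 by simp
qed simp

end
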